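(* (Uniqueness.) Let $V$ be an $N_W=N$ SUSY vertex algebra and let $a(Z)$ be an $\mathrm{End}(V)$-valued field such that the pair $(a(Z),Y(b,Z))$ is local for every $b\in V$, and $a(Z)|0\rangle=0$. Then $a(Z)=0$.
   Context: Ground field $\mathbb C$; $N\ge0$ a fixed integer. $Z=(z,\theta^1,\dots,\theta^N)$, $W=(w,\zeta^1,\dots,\zeta^N)$, $z,w$ even, $\theta^i,\zeta^i$ odd; odd variables anticommute with each other and supercommute with elements of superspaces; $[\ ,\ ]$ is the supercommutator. For $I=\{i_1<\dots<i_k\}\subset\{1,\dots,N\}$, $Z^{n|I}=z^n\theta^{i_1}\cdots\theta^{i_k}$. An $\mathrm{End}(V)$-valued field is a formal sum $a(Z)=\sum_{n\in\mathbb Z,I}Z^{n|I}a_{n|I}$, $a_{n|I}\in\mathrm{End}(V)$, with $a(Z)v\in V((z))[\theta^1,\dots,\theta^N]$ for all $v\in V$ (homogeneous of parity $p$ if $a_{n|I}$ has parity $p+\#I$; fields are assumed homogeneous). A pair of fields $(a(Z),b(Z))$ is local if $(z-w)^n[a(Z),b(W)]=0$ for some $n\in\mathbb Z_{\ge0}$. An $N_W=N$ SUSY vertex algebra is a vector superspace $V$ with an even vector $|0\rangle$, an even operator $T$, odd operators $S^1,\dots,S^N$, and a parity preserving linear map $a\mapsto Y(a,Z)$ from $V$ to $\mathrm{End}(V)$-valued fields such that: (vacuum) $Y(a,Z)|0\rangle\in V[[z]][\theta^1,\dots,\theta^N]$ has value $a$ at $Z=0$, and $T|0\rangle=S^i|0\rangle=0$;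 (translation invariance) $[T,Y(a,Z)]=\partial_zY(a,Z)$, $[S^i,Y(a,Z)]=\partial_{\theta^i}Y(a,Z)$; (locality) for all $a,b$, $(z-w)^n[Y(a,Z),Y(b,W)]=0$ for some $n\in\mathbb Z_{\ge0}$. *)

theory Defs
  imports Complex_Main "HOL-Library.Z2"
begin

text \<open>Parities are elements of \<^typ>\<open>bit\<close>, the field with two elements, so that parities add and
  multiply as usual; \<open>signed p x\<close> is \<open>(-1)^p x\<close>.\<close>

definition signed :: "bit \<Rightarrow> 'v::ab_group_add \<Rightarrow> 'v" where
  "signed p x = (if p = 0 then x else - x)"

locale vector_superspace = vector_space scale
  for scale :: "complex \<Rightarrow> 'v::ab_group_add \<Rightarrow> 'v" +
  fixes V :: "bit \<Rightarrow> 'v set"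
  assumes subspace_V: "subspace (V p)"
    and V_inter: "V 0 \<inter> V 1 = {0}"
    and V_sum: "\<exists>x\<in>V 0. \<exists>y\<in>V 1. v = x + y"

definition hom_part :: "(bit \<Rightarrow> 'v set) \<Rightarrow> bit \<Rightarrow> 'v::ab_group_add \<Rightarrow> 'v" where
  "hom_part V p v = (THE x. x \<in> V p \<and> v - x \<in> V (p + 1))"

definition endo_parity :: "(bit \<Rightarrow> 'v set) \<Rightarrow> bit \<Rightarrow> ('v \<Rightarrow> 'v) \<Rightarrow> bool" where
  "endo_parity V p A \<longleftrightarrow> (\<forall>q. \<forall>v\<in>V q. A v \<in> V (p + q))"

definition endo_part :: "(bit \<Rightarrow> 'v set) \<Rightarrow> bit \<Rightarrow> ('v::ab_group_add \<Rightarrow> 'v) \<Rightarrow> 'v \<Rightarrow> 'v" where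
  "endo_part V p A v =
     hom_part V p (A (hom_part V 0 v)) + hom_part V (p + 1) (A (hom_part V 1 v))"

text \<open>The supercommutator \<open>A B - (-1)^(p q) B A\<close> of endomorphisms of parities \<open>p\<close> and \<open>q\<close>,
  extended bilinearly to all endomorphisms.\<close>

definition supercomm ::
    "(bit \<Rightarrow> 'v set) \<Rightarrow> ('v::ab_group_add \<Rightarrow> 'v) \<Rightarrow> ('v \<Rightarrow> 'v) \<Rightarrow> 'v \<Rightarrow> 'v" where
  "supercomm V A B v = (\<Sum>p\<in>{0, 1}. \<Sum>q\<in>{0, 1}.
     endo_part V p A (endo_part V q B v) - signed (p * q) (endo_part V q B (endo_part V p A v)))"

text \<open>A formal sum \<open>\<Sum> Z^(n|I) a_(n|I)\<close> is represented by its coefficient family \<open>a n I\<close>, where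
  \<open>I\<close> is a set of indices of odd variables. Coefficients stand to the right of the variables and
  the odd variables are multiplied in increasing order of their indices. Only \<open>I \<subseteq> {1..N}\<close>
  is meaningful; the remaining coefficients of a field are required to vanish.\<close>

type_synonym 'v distribution = "int \<Rightarrow> nat set \<Rightarrow> 'v \<Rightarrow> 'v"

text \<open>In two sets of variables, \<open>c n I m J\<close> is the coefficient of \<open>Z^(n|I) W^(m|J)\<close>.\<close>

type_synonym 'v distribution2 = "int \<Rightarrow> nat set \<Rightarrow> int \<Rightarrow> nat set \<Rightarrow> 'v \<Rightarrow> 'v"

abbreviation set_parity :: "nat set \<Rightarrow> bit" where
  "set_parity I \<equiv> of_nat (card I)"

definition end_field ::
    "(complex \<Rightarrow> 'v \<Rightarrow> 'v) \<Rightarrow> nat \<Rightarrow> 'v::ab_group_add distribution \<Rightarrow> bool" where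
  "end_field scale N a \<longleftrightarrow>
     (\<forall>n I. Vector_Spaces.linear scale scale (a n I)) \<and>
     (\<forall>n I v. \<not> I \<subseteq> {1..N} \<longrightarrow> a n I v = 0) \<and>
     (\<forall>v. \<forall>I\<subseteq>{1..N}. \<exists>n0. \<forall>n<n0. a n I v = 0)"

definition field_parity :: "(bit \<Rightarrow> 'v set) \<Rightarrow> bit \<Rightarrow> 'v distribution \<Rightarrow> bool" where
  "field_parity V p a \<longleftrightarrow> (\<forall>n I. endo_parity V (p + set_parity I) (a n I))"

text \<open>For an operator \<open>X\<close> of parity \<open>r\<close>, moving the odd variables of \<open>Z^(n|I)\<close> to the left of \<open>X\<close>
  gives \<open>[X, Z^(n|I) A] = (-1)^(r |I|) Z^(n|I) [X, A]\<close>.\<close>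

definition op_comm ::
    "(bit \<Rightarrow> 'v set) \<Rightarrow> bit \<Rightarrow> ('v::ab_group_add \<Rightarrow> 'v) \<Rightarrow> 'v distribution \<Rightarrow> 'v distribution" where
  "op_comm V r X a n I v = signed (r * set_parity I) (supercomm V X (a n I) v)"

definition d_even :: "(complex \<Rightarrow> 'v \<Rightarrow> 'v) \<Rightarrow> 'v distribution \<Rightarrow> 'v distribution" where
  "d_even scale a n I v = scale (of_int (n + 1)) (a (n + 1) I v)"

text \<open>The left derivative with respect to the \<open>i\<close>-th odd variable: that variable is moved to the
  front of the monomial, past the variables with smaller index, and then removed.\<close>

definition d_odd :: "nat \<Rightarrow> 'v::ab_group_add distribution \<Rightarrow> 'v distribution" where
  "d_odd i a n I v =
     (if i \<in> I then 0 else signed (set_parity {j\<in>I. j < i}) (a n (insert i I) v))"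

text \<open>The supercommutator \<open>[a(Z), b(W)]\<close>: for \<open>A\<close> of parity \<open>p\<close>,
  \<open>[Z^(n|I) A, W^(m|J) B] = (-1)^(p |J|) Z^(n|I) W^(m|J) [A, B]\<close>.\<close>

definition field_comm ::
    "(bit \<Rightarrow> 'v set) \<Rightarrow> 'v::ab_group_add distribution \<Rightarrow> 'v distribution \<Rightarrow> 'v distribution2" where
  "field_comm V a b n I m J v =
     (\<Sum>p\<in>{0, 1}. signed (p * set_parity J) (supercomm V (endo_part V p (a n I)) (b m J) v))"

text \<open>Multiplication by \<open>z - w\<close>.\<close>

definition times_zw :: "'v::ab_group_add distribution2 \<Rightarrow> 'v distribution2" where
  "times_zw c n I m J v = c (n - 1) I m J v - c n I (m - 1) J v"

definition local_pair ::
    "(bit \<Rightarrow> 'v set) \<Rightarrow> 'v::ab_group_add distribution \<Rightarrow> 'v distribution \<Rightarrow> bool" where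
  "local_pair V a b \<longleftrightarrow> (\<exists>k. (times_zw ^^ k) (field_comm V a b) = (\<lambda>n I m J v. 0))"

locale susy_vertex_algebra = vector_superspace scale V
  for scale :: "complex \<Rightarrow> 'v::ab_group_add \<Rightarrow> 'v" and V :: "bit \<Rightarrow> 'v set" +
  fixes N :: nat and vac :: 'v and T :: "'v \<Rightarrow> 'v" and S :: "nat \<Rightarrow> 'v \<Rightarrow> 'v"
    and Y :: "'v \<Rightarrow> 'v distribution"
  assumes vac_even: "vac \<in> V 0"
    and T_linear: "Vector_Spaces.linear scale scale T"
    and T_even: "endo_parity V 0 T"
    and S_linear: "i \<in> {1..N} \<Longrightarrow> Vector_Spaces.linear scale scale (S i)"
    and S_odd: "i \<in> {1..N} \<Longrightarrow> endo_parity V 1 (S i)"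
    and Y_field: "end_field scale N (Y a)"
    and Y_linear: "Vector_Spaces.linear scale scale (\<lambda>a. Y a n I v)"
    and Y_parity: "a \<in> V p \<Longrightarrow> field_parity V p (Y a)"
    and vacuum_regular: "n < 0 \<Longrightarrow> Y a n I vac = 0"
    and vacuum_value: "Y a 0 {} vac = a"
    and T_vac: "T vac = 0"
    and S_vac: "i \<in> {1..N} \<Longrightarrow> S i vac = 0"
    and T_translation: "op_comm V 0 T (Y a) = d_even scale (Y a)"
    and S_translation: "i \<in> {1..N} \<Longrightarrow> op_comm V 1 (S i) (Y a) = d_odd i (Y a)"
    and locality: "local_pair V (Y a) (Y b)"

end

theory Submission
  imports Defs
begin

text \<open>Apply \<open>(z - w)^k [a(Z), Y(b,W)] = 0\<close> to the vacuum. The terms \<open>Y(b,W) a(Z)|0\<rangle>\<close> vanish, and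
  what remains, \<open>(z - w)^k a(Z) Y(b,W)|0\<rangle>\<close>, is regular in \<open>W\<close>; setting \<open>W = 0\<close> gives
  \<open>z^k a(Z) b = 0\<close>.\<close>

context vector_superspace
begin

text \<open>Together with \<open>hom_part_unique\<close>, this makes the definite description in
  \<open>hom_part\<close> meaningful.\<close>

lemma hom_part_exists: "\<exists>x. x \<in> V p \<and> v - x \<in> V (p + 1)"
proof -
  obtain x y where xy: "x \<in> V 0" "y \<in> V 1" "v = x + y"
    using V_sum by blast
  show ?thesis
  proof (cases p)
    case zero
    then show ?thesis using xy by (intro exI[of _ x]) auto
  next
    case one
    then show ?thesis using xy by (intro exI[of _ y]) auto
  qed
qed

lemma hom_part_unique:
  assumes x: "x \<in> V p" "v - x \<in> V (p + 1)" and y: "y \<in> V p" "v - y \<in> V (p + 1)"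
  shows "x = y"
proof -
  have "x - y \<in> V p"
    using x(1) y(1) subspace_V by (rule subspace_diff[rotated])
  moreover have "(v - y) - (v - x) \<in> V (p + 1)"
    using x(2) y(2) subspace_V by (blast intro: subspace_diff)
  ultimately have "x - y \<in> V 0 \<inter> V 1"
    by (cases p) auto
  then show ?thesis
    using V_inter by simp
qed

lemma hom_part_eqI: "x \<in> V p \<Longrightarrow> v - x \<in> V (p + 1) \<Longrightarrow> hom_part V p v = x"
  unfolding hom_part_def by (rule the_equality) (auto intro: hom_part_unique)

lemma hom_part_mem: "hom_part V p v \<in> V p"
  and hom_part_compl: "v - hom_part V p v \<in> V (p + 1)"
  using hom_part_exists[of p v] hom_part_eqI by auto

lemma additive_hom_part: "additive (hom_part V p)"
proof
  fix v w
  have "v + w - (hom_part V p v + hom_part V p w) = (v - hom_part V p v) + (w - hom_part V p w)"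
    by simp
  then show "hom_part V p (v + w) = hom_part V p v + hom_part V p w"
    by (intro hom_part_eqI) (metis subspace_add subspace_V hom_part_mem hom_part_compl)+
qed

lemma hom_part_sum: "hom_part V 0 v + hom_part V 1 v = v"
proof -
  have "hom_part V 1 v = v - hom_part V 0 v"
    using hom_part_mem[of 0 v] hom_part_compl[of v 0] by (intro hom_part_eqI) auto
  then show ?thesis by simp
qed

lemma additive_endo_part:
  assumes "additive A"
  shows "additive (endo_part V p A)"
  by unfold_locales
    (simp add: endo_part_def additive.add[OF assms] additive.add[OF additive_hom_part])

lemma endo_part_zero:
  assumes "additive A"
  shows "endo_part V p A 0 = 0"
  using additive_endo_part[OF assms] by (rule additive.zero)

lemma endo_part_sum:
  assumes "additive A"
  shows "endo_part V 0 A v + endo_part V 1 A v = A v"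
proof -
  \<comment> \<open>The two parity parts of \<open>A\<close> split it into four blocks; grouping
    these by the component of \<open>v\<close> they act on lets \<open>hom_part_sum\<close>
    recombine each pair.\<close>
  have "endo_part V 0 A v + endo_part V 1 A v
      = (hom_part V 0 (A (hom_part V 0 v)) + hom_part V 1 (A (hom_part V 0 v)))
        + (hom_part V 0 (A (hom_part V 1 v)) + hom_part V 1 (A (hom_part V 1 v)))"
    by (simp add: endo_part_def)
  then show ?thesis
    by (simp only: hom_part_sum flip: additive.add[OF assms])
qed

text \<open>An even \<open>v\<close> has components \<open>v\<close> and 0, so each part of
  \<open>A\<close> only sees \<open>A v\<close>. For a mixed \<open>v\<close>,
  \<open>A v = 0\<close> could come from cancellation between the images of its two
  components.\<close>

lemma endo_part_even_eq_0:
  assumes "additive A" and "v \<in> V 0" and "A v = 0"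
  shows "endo_part V p A v = 0"
proof -
  have v: "hom_part V 0 v = v"
    using assms(2) subspace_0[OF subspace_V] by (intro hom_part_eqI) auto
  moreover have "hom_part V 1 v = 0"
    using hom_part_sum[of v] v by simp
  ultimately show ?thesis
    using assms by (simp add: endo_part_def additive.zero additive_hom_part)
qed

text \<open>Every term with \<open>B\<close> on the left contains a part of \<open>A\<close> applied
  to \<open>v\<close> and vanishes, whatever its sign. The other terms carry no sign, so summing
  over both parities restores \<open>A\<close> and \<open>B\<close>.\<close>

lemma supercomm_annihilated:
  assumes A: "additive A" and B: "additive B" and v: "v \<in> V 0" "A v = 0"
  shows "supercomm V A B v = A (B v)"
proof -
  have "endo_part V p A (endo_part V 0 B v) + endo_part V p A (endo_part V 1 B v)
      = endo_part V p A (B v)" for p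
    by (simp add: endo_part_sum[OF B] flip: additive.add[OF additive_endo_part[OF A]])
  then show ?thesis
    by (simp add: supercomm_def endo_part_even_eq_0[OF A v] endo_part_zero[OF B] signed_def
        endo_part_sum[OF A])
qed

text \<open>For \<open>J = {}\<close> no odd variable of \<open>W\<close> is moved past a
  coefficient of \<open>a\<close>, so the sign is trivial and the parity parts of
  \<open>a n I\<close> add up again.\<close>

lemma field_comm_annihilated:
  assumes A: "additive (a n I)" and B: "additive (b m {})" and v: "v \<in> V 0" "a n I v = 0"
  shows "field_comm V a b n I m {} v = a n I (b m {} v)"
  by (simp add: field_comm_def signed_def endo_part_sum[OF A]
      supercomm_annihilated[OF additive_endo_part[OF A] B v(1) endo_part_even_eq_0[OF A v]])

end

text \<open>In a series without negative powers of \<open>w\<close>, every term of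
  \<open>(z - w)^k\<close> other than \<open>z^k\<close> contributes only positive powers of
  \<open>w\<close>. At \<open>w^0\<close> only the shift by \<open>z^k\<close> is left.\<close>

lemma times_zw_power_regular:
  assumes "\<And>n m. m < 0 \<Longrightarrow> c n I m J v = 0"
  shows "m < 0 \<Longrightarrow> (times_zw ^^ k) c n I m J v = 0"
    and "(times_zw ^^ k) c n I 0 J v = c (n - int k) I 0 J v"
proof (induction k arbitrary: n m)
  case 0
  { case 1 then show ?case using assms by simp }
  { case 2 then show ?case by simp }
next
  case (Suc k)
  { case 1 then show ?case using Suc.IH(1) by (simp add: times_zw_def) }
  \<comment> \<open>The subtracted coefficient sits at \<open>w^(-1)\<close> and vanishes by the
    first claim.\<close>
  { case 2 then show ?case using Suc.IH by (simp add: times_zw_def algebra_simps) }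
qed

lemma linear_additive: "Vector_Spaces.linear s1 s2 f \<Longrightarrow> additive f"
  by unfold_locales (simp add: linear_iff_module_hom module_hom.add)

theorem proposition3p3p8:
  fixes scale :: "complex \<Rightarrow> 'v::ab_group_add \<Rightarrow> 'v"
    and V :: "bit \<Rightarrow> 'v set" and N :: nat and vac :: 'v
    and T :: "'v \<Rightarrow> 'v" and S :: "nat \<Rightarrow> 'v \<Rightarrow> 'v"
    and Y :: "'v \<Rightarrow> 'v distribution" and a :: "'v distribution" and p :: bit
  assumes "susy_vertex_algebra scale V N vac T S Y"
    and "end_field scale N a"
    and "field_parity V p a"
    and "\<forall>b. local_pair V a (Y b)"
    and "\<forall>n I. a n I vac = 0"
  shows "a = (\<lambda>n I v. 0)"
proof (intro ext)
  fix n I b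
  interpret susy_vertex_algebra scale V N vac T S Y by fact
  let ?c = "field_comm V a (Y b)"
  have a: "additive (a n I)" for n I
    using assms(2) by (auto simp: end_field_def intro: linear_additive)
  have Y: "additive (Y b m J)" for m J
    using Y_field[of b] by (auto simp: end_field_def intro: linear_additive)
  \<comment> \<open>Setting \<open>W = 0\<close> also kills the odd variables, so
    \<open>J = {}\<close> suffices.\<close>
  have c: "?c n I m {} vac = a n I (Y b m {} vac)" for n m
    using a Y vac_even assms(5) by (simp add: field_comm_annihilated)
  obtain k where "(times_zw ^^ k) ?c = (\<lambda>n I m J v. 0)"
    using assms(4) unfolding local_pair_def by blast
  \<comment> \<open>The index \<open>n + int k\<close> offsets the shift caused by
    \<open>z^k\<close>.\<close>
  then have "0 = (times_zw ^^ k) ?c (n + int k) I 0 {} vac"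
    by simp
  also have "\<dots> = ?c n I 0 {} vac"
    by (subst times_zw_power_regular(2)) (simp_all add: c vacuum_regular additive.zero[OF a])
  also have "\<dots> = a n I b"
    by (simp add: c vacuum_value)
  finally show "a n I b = 0" ..
qed

end
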